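(* Let $X$ be a nonempty set and let $\mathcal{F}(X)$ be the set of all nonempty finite subsets of $X$. The following two statements are equivalent for every function $\tau:\mathcal{F}(X)\rightarrow\mathbb{R}$. (i) For all $A,B,C\in\mathcal{F}(X)$ the function $\tau$ satisfies the conditions: (i$_1$) $\tau(A)=0$ if and only if $\operatorname{card} A=1$; (i$_2$) $\tau(A\cup B)\leqslant \max\{\tau(A\cup C),\tau(C\cup B)\}$. (ii) There is an ultrametric $\rho:X\times X\rightarrow\mathbb{R}^+$ such that $\tau(A)=\operatorname{diam} A$ for every $A\in\mathcal{F}(X)$, where $\operatorname{diam} A=\sup\{\rho(x,y):x,y\in A\}$.
   Context: $\mathbb{R}^+=[0,\infty)$. An ultrametric on $X$ is a metric $\rho:X\times X\to\mathbb{R}^+$ satisfying $\rho(x,y)\leqslant\max\{\rho(x,z),\rho(z,y)\}$ for all $x,y,z\in X$. *)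

theory Defs
  imports "HOL-Analysis.Analysis"
begin

definition nonempty_finite_subsets :: "'a set \<Rightarrow> 'a set set" where
  "nonempty_finite_subsets X = {A. A \<subseteq> X \<and> finite A \<and> A \<noteq> {}}"

(* \<open>Metric_space X \<rho>\<close> demands nonnegativity and symmetry of \<rho> on the whole type, but the
   remaining axioms on X only.  Every metric on X extends to such a \<rho> (by 0 outside
   X \<times> X), so an existential quantifier over \<rho> ranges over the metrics on X. *)
locale Ultrametric_space = Metric_space X \<rho>
  for X :: "'a set" and \<rho> :: "'a \<Rightarrow> 'a \<Rightarrow> real" +
  assumes ultratriangle:
    "\<lbrakk>x \<in> X; y \<in> X; z \<in> X\<rbrakk> \<Longrightarrow> \<rho> x y \<le> max (\<rho> x z) (\<rho> z y)"

(* The supremum is taken in the reals, hence meaningful only if A is nonempty and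
   \<rho> is bounded on A \<times> A; both hold for the nonempty finite sets A considered here. *)
definition diam :: "('a \<Rightarrow> 'a \<Rightarrow> real) \<Rightarrow> 'a set \<Rightarrow> real" where
  "diam \<rho> A = Sup {\<rho> x y | x y. x \<in> A \<and> y \<in> A}"

end

(* The inequality in (i) with A = {x}, B = {y} and C a finite set containing x and y reads
   \<tau> {x, y} \<le> \<tau> C; with C = {a} and a in A it reads \<tau> (A \<union> B) \<le> max (\<tau> A) (\<tau> ({a} \<union> B)).
   The former bounds \<tau> from below, and the latter, adding one point at a time, from above by its
   values on two-point subsets, so \<tau> is the diameter for the ultrametric \<rho> x y = \<tau> {x, y}. *)
theory Submission
  imports Defs
begin

text \<open>Finitely many distances form a nonempty finite set of reals, so its supremum is a
  genuine least upper bound. Every later estimate of a diameter from above thereby reduces to an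
  estimate for pairs of points.\<close>

lemma diam_le_iff:
  assumes "finite A" "A \<noteq> {}"
  shows "diam \<rho> A \<le> r \<longleftrightarrow> (\<forall>x\<in>A. \<forall>y\<in>A. \<rho> x y \<le> r)"
proof -
  let ?S = "{\<rho> x y | x y. x \<in> A \<and> y \<in> A}"
  have "?S = (\<lambda>(x, y). \<rho> x y) ` (A \<times> A)"
    by auto
  then have "finite ?S" "?S \<noteq> {}"
    using assms by auto
  then show ?thesis
    unfolding diam_def by (subst cSup_le_iff) auto
qed

lemma le_diam:
  assumes "finite A" "x \<in> A" "y \<in> A"
  shows "\<rho> x y \<le> diam \<rho> A"
  using assms diam_le_iff[of A \<rho> "diam \<rho> A"] by blast

text \<open>Each distance within \<open>A\<close> lies between 0 and the diameter, so a vanishing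
  diameter forces any two points of \<open>A\<close> to coincide.\<close>

lemma (in Metric_space) diam_eq_0_iff:
  assumes "finite A" "A \<noteq> {}" "A \<subseteq> M"
  shows "diam d A = 0 \<longleftrightarrow> card A = 1"
proof
  assume diam0: "diam d A = 0"
  have "x = y" if "x \<in> A" "y \<in> A" for x y
  proof -
    have "d x y \<le> 0"
      using le_diam[OF \<open>finite A\<close> that, of d] diam0 by simp
    then show "x = y"
      using that \<open>A \<subseteq> M\<close> zero[of x y] nonneg[of x y] by (metis antisym subsetD)
  qed
  then show "card A = 1"
    using \<open>A \<noteq> {}\<close> by (metis is_singletonI' is_singleton_altdef)
next
  assume "card A = 1"
  then obtain x where "A = {x}"
    by (auto simp: card_1_singleton_iff)
  then show "diam d A = 0"
    using \<open>A \<subseteq> M\<close> by (simp add: diam_def)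
qed

text \<open>Two points of \<open>A\<close>, or two points of \<open>B\<close>, both lie in one of
  the sets on the right. A point of \<open>A\<close> and a point of \<open>B\<close> are compared
  through an arbitrary fixed point of \<open>C\<close>.\<close>

lemma (in Ultrametric_space) diam_Un_le:
  assumes fin: "finite A" "finite B" "finite C"
    and "A \<noteq> {}" "C \<noteq> {}"
    and sub: "A \<subseteq> X" "B \<subseteq> X" "C \<subseteq> X"
  shows "diam \<rho> (A \<union> B) \<le> max (diam \<rho> (A \<union> C)) (diam \<rho> (C \<union> B))" (is "_ \<le> ?m")
proof -
  obtain c where c: "c \<in> C"
    using \<open>C \<noteq> {}\<close> by blast
  have AC: "\<rho> x y \<le> ?m" if "x \<in> A \<union> C" "y \<in> A \<union> C" for x y
    using le_diam[OF _ that, of \<rho>] fin by fastforce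
  have CB: "\<rho> x y \<le> ?m" if "x \<in> C \<union> B" "y \<in> C \<union> B" for x y
    using le_diam[OF _ that, of \<rho>] fin by fastforce
  have AB: "\<rho> x y \<le> ?m" if "x \<in> A" "y \<in> B" for x y
  proof -
    have "\<rho> x y \<le> max (\<rho> x c) (\<rho> c y)"
      using that c sub by (intro ultratriangle) auto
    also have "\<dots> \<le> ?m"
      using AC[of x c] CB[of c y] that c by simp
    finally show ?thesis .
  qed
  have "\<rho> x y \<le> ?m" if "x \<in> A \<union> B" "y \<in> A \<union> B" for x y
    \<comment> \<open>Four cases, by the set that contains each point; the case of \<open>x\<close>
      in \<open>B\<close> and \<open>y\<close> in \<open>A\<close> is reduced by symmetry to
      \<open>AB\<close>.\<close>
    using that AC[of x y] CB[of x y] AB[of x y] AB[of y x] commute[of x y]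
    by (metis UnCI UnE)
  moreover have "finite (A \<union> B)" "A \<union> B \<noteq> {}"
    using assms by auto
  ultimately show ?thesis
    by (subst diam_le_iff) blast+
qed

locale ultrametric_set_function =
  fixes X :: "'a set" and \<tau> :: "'a set \<Rightarrow> real"
  assumes eq_0_iff: "A \<in> nonempty_finite_subsets X \<Longrightarrow> \<tau> A = 0 \<longleftrightarrow> card A = 1"
    and Un_le: "\<lbrakk>A \<in> nonempty_finite_subsets X; B \<in> nonempty_finite_subsets X;
        C \<in> nonempty_finite_subsets X\<rbrakk> \<Longrightarrow> \<tau> (A \<union> B) \<le> max (\<tau> (A \<union> C)) (\<tau> (C \<union> B))"
begin

(* The value 0 off X is needed because Metric_space demands nonnegativity on the whole type. *)
definition pair_dist :: "'a \<Rightarrow> 'a \<Rightarrow> real" where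
  "pair_dist x y = (if x \<in> X \<and> y \<in> X then \<tau> {x, y} else 0)"

lemma singleton_eq_0: "x \<in> X \<Longrightarrow> \<tau> {x} = 0"
  by (simp add: eq_0_iff nonempty_finite_subsets_def)

text \<open>Comparing \<open>{x}\<close> with itself through \<open>{y}\<close> gives 0 = \<tau> {x}
  \<le> \<tau> {x, y}, as both terms of the maximum agree.\<close>

lemma pair_nonneg:
  assumes "x \<in> X" "y \<in> X"
  shows "0 \<le> \<tau> {x, y}"
  using assms Un_le[of "{x}" "{x}" "{y}"]
  by (simp add: nonempty_finite_subsets_def singleton_eq_0 insert_commute)

lemma pair_eq_0_iff:
  assumes "x \<in> X" "y \<in> X"
  shows "\<tau> {x, y} = 0 \<longleftrightarrow> x = y"
  using assms by (simp add: eq_0_iff nonempty_finite_subsets_def card_insert_if)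

lemma pair_le_max:
  assumes "x \<in> X" "y \<in> X" "z \<in> X"
  shows "\<tau> {x, y} \<le> max (\<tau> {x, z}) (\<tau> {z, y})"
  using assms Un_le[of "{x}" "{y}" "{z}"]
  by (simp add: nonempty_finite_subsets_def insert_commute)

lemma Ultrametric_space_pair_dist: "Ultrametric_space X pair_dist"
proof
  show "0 \<le> pair_dist x y" for x y
    by (simp add: pair_dist_def pair_nonneg)
  show "pair_dist x y = pair_dist y x" for x y
    by (simp add: pair_dist_def insert_commute)
  show "pair_dist x y = 0 \<longleftrightarrow> x = y" if "x \<in> X" "y \<in> X" for x y
    using that by (simp add: pair_dist_def pair_eq_0_iff)
  show "pair_dist x z \<le> pair_dist x y + pair_dist y z"
    if "x \<in> X" "y \<in> X" "z \<in> X" for x y z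
    \<comment> \<open>The maximum of two nonnegative numbers is at most their sum.\<close>
    using that pair_le_max[of x z y] pair_nonneg[of x y] pair_nonneg[of y z]
    by (simp add: pair_dist_def)
  show "pair_dist x y \<le> max (pair_dist x z) (pair_dist z y)"
    if "x \<in> X" "y \<in> X" "z \<in> X" for x y z
    using that pair_le_max by (simp add: pair_dist_def)
qed

lemma pair_le:
  assumes A: "A \<in> nonempty_finite_subsets X" and "x \<in> A" "y \<in> A"
  shows "\<tau> {x, y} \<le> \<tau> A"
proof -
  have "{x} \<in> nonempty_finite_subsets X" "{y} \<in> nonempty_finite_subsets X"
    using assms by (auto simp: nonempty_finite_subsets_def)
  \<comment> \<open>Since \<open>A\<close> absorbs both \<open>{x}\<close> and \<open>{y}\<close>,
    each term of the maximum is \<tau> A.\<close>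
  from Un_le[OF this A] show ?thesis
    using assms(2,3) by (simp add: insert_absorb insert_commute)
qed

text \<open>Adjoining a point \<open>x\<close> to \<open>A\<close> raises \<tau> to at most the
  maximum of \<tau> A and \<tau> {a, x}, for any \<open>a\<close> in \<open>A\<close>; so a bound on
  all pairs survives the induction.\<close>

lemma le_if_pairs_le:
  assumes "finite A" "A \<noteq> {}" "A \<subseteq> X" "\<And>x y. \<lbrakk>x \<in> A; y \<in> A\<rbrakk> \<Longrightarrow> \<tau> {x, y} \<le> r"
  shows "\<tau> A \<le> r"
  using assms
proof (induction rule: finite_ne_induct)
  \<comment> \<open>The degenerate pair \<open>{x, x}\<close> is the singleton itself.\<close>
  case (singleton x)
  from singleton.prems(2)[of x x] show ?case
    by simp
next
  case (insert x A)
  obtain a where "a \<in> A"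
    using insert.hyps by blast
  have "\<tau> (A \<union> {x}) \<le> max (\<tau> (A \<union> {a})) (\<tau> ({a} \<union> {x}))"
    using insert.hyps insert.prems \<open>a \<in> A\<close>
    by (intro Un_le) (auto simp: nonempty_finite_subsets_def)
  moreover have "\<tau> A \<le> r"
    using insert.IH insert.prems by blast
  moreover have "\<tau> {a, x} \<le> r"
    using insert.prems(2) \<open>a \<in> A\<close> by blast
  ultimately show ?case
    using \<open>a \<in> A\<close> by (simp add: insert_absorb insert_commute)
qed

lemma eq_diam_pair_dist:
  assumes "A \<in> nonempty_finite_subsets X"
  shows "\<tau> A = diam pair_dist A"
proof (rule antisym)
  have A: "finite A" "A \<noteq> {}" "A \<subseteq> X"
    using assms by (auto simp: nonempty_finite_subsets_def)
  then have pair: "pair_dist x y = \<tau> {x, y}" if "x \<in> A" "y \<in> A" for x y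
    using that by (auto simp: pair_dist_def)
  show "\<tau> A \<le> diam pair_dist A"
    \<comment> \<open>The diameter itself serves as the common bound \<open>r\<close> for the
      pairs.\<close>
    using le_diam[OF \<open>finite A\<close>, of _ _ pair_dist] pair by (intro le_if_pairs_le[OF A]) simp
  show "diam pair_dist A \<le> \<tau> A"
    using A pair pair_le[OF assms] by (simp add: diam_le_iff)
qed

end

theorem theorem2p1:
  fixes X :: "'a set" and \<tau> :: "'a set \<Rightarrow> real"
  assumes "X \<noteq> {}"
  shows "(\<forall>A \<in> nonempty_finite_subsets X. \<forall>B \<in> nonempty_finite_subsets X.
            \<forall>C \<in> nonempty_finite_subsets X.
              (\<tau> A = 0 \<longleftrightarrow> card A = 1) \<and>
              \<tau> (A \<union> B) \<le> max (\<tau> (A \<union> C)) (\<tau> (C \<union> B)))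
     \<longleftrightarrow> (\<exists>\<rho>. Ultrametric_space X \<rho> \<and>
              (\<forall>A \<in> nonempty_finite_subsets X. \<tau> A = diam \<rho> A))"
    (is "?i \<longleftrightarrow> ?ii")
proof
  assume ?i
  \<comment> \<open>The condition on \<open>card A\<close> stands under quantifiers over
    \<open>B\<close> and \<open>C\<close> too; these can be instantiated with
    \<open>A\<close>.\<close>
  then interpret ultrametric_set_function X \<tau>
    by unfold_locales blast+
  show ?ii
    using Ultrametric_space_pair_dist eq_diam_pair_dist by blast
next
  assume ?ii
  then obtain \<rho> where "Ultrametric_space X \<rho>"
    and \<tau>: "\<And>A. A \<in> nonempty_finite_subsets X \<Longrightarrow> \<tau> A = diam \<rho> A"
    by blast
  then interpret Ultrametric_space X \<rho>
    by simp
  show ?i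
  proof (intro ballI conjI)
    fix A B C
    assume ABC: "A \<in> nonempty_finite_subsets X" "B \<in> nonempty_finite_subsets X"
      "C \<in> nonempty_finite_subsets X"
    show "\<tau> A = 0 \<longleftrightarrow> card A = 1"
      using ABC(1) diam_eq_0_iff[of A] by (simp add: \<tau> nonempty_finite_subsets_def)
    \<comment> \<open>Membership of the unions allows \<tau> to be replaced by the diameter in all
      three terms.\<close>
    have "A \<union> B \<in> nonempty_finite_subsets X" "A \<union> C \<in> nonempty_finite_subsets X"
      "C \<union> B \<in> nonempty_finite_subsets X"
      using ABC by (auto simp: nonempty_finite_subsets_def)
    then show "\<tau> (A \<union> B) \<le> max (\<tau> (A \<union> C)) (\<tau> (C \<union> B))"
      using ABC diam_Un_le[of A B C] by (simp add: \<tau> nonempty_finite_subsets_def)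
  qed
qed

end
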